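(* Let $(A,B)$ be a controllable multi-input pair, $A\in\mathbb{C}^{n\times n}$, $B\in\mathbb{C}^{n\times m}$, let $k$ be the cyclic index of $A$, and suppose $(A,B)$ is written in the block form described in the context, with associated matrices $M_1,\dots,M_{k+1}$. Let $t\ge0$ and let $\sigma$ be a switching signal with values in $\{0,1\}$. Then the controllability Gramian $W_{\sigma(t)}$ is positive definite if and only if $$\bigcap_{i=1}^{k+1}\ker(M_i)=0 .$$
   Context: The system is $x(s+1)=Ax(s)+B\sigma(s)u(s)$ with $\sigma(s)\in\{0,1\}$, and $W_{\sigma(t)}=\sum_{i=0}^{t}\sigma(t-i)A^iBB^*(A^* )^i$, where $*$ is the conjugate transpose. The cyclic index $k$ of $A$ is the number of non-trivial invariant factors $\alpha_1,\dots,\alpha_k$ of $A$. The pair is taken in a basis in which $$A=\begin{bmatrix}A_1&0&\cdots&0\\0&A_2&\cdots&0\\ \vdots&&\ddots&\vdots\\0&0&\cdots&A_k\end{bmatrix},\qquad B=\begin{bmatrix}b_{11}&b_{12}&\cdots&b_{1k}&*\\0&b_{22}&\cdots&b_{2k}&*\\ \vdots&&\ddots&\vdots&\vdots\\0&0&\cdots&b_{kk}&*\end{bmatrix},$$ where $A_i$ is cyclic with minimal polynomial $\alpha_i$, each pair $(A_i,b_{ii})$ is controllable with $b_{ii}$ a column vector, and the entries $*$ in $B$ stand for all the remaining $m-k$ columns. Let $b_1,\dots,b_k$ be the first $k$ columns of this $B$ and let $B_{k+1}$ be the matrix of the remaining $m-k$ columns, so $BB^*=\sum_{j=1}^kb_jb_j^*+B_{k+1}B_{k+1}^*$.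 Define $$M_j=\sum_{i=0}^{t}\sigma(t-i)A^ib_jb_j^*(A^* )^i\quad(1\le j\le k),\qquad M_{k+1}=\sum_{i=0}^{t}\sigma(t-i)A^iB_{k+1}B_{k+1}^*(A^* )^i,$$ with $M_{k+1}=0$ if $m=k$. *)

theory Defs
  imports
    "HOL-Computational_Algebra.Field_as_Ring"
    "HOL-Computational_Algebra.Polynomial_Factorial"
    "Jordan_Normal_Form.Matrix_Kernel"
    "Jordan_Normal_Form.Schur_Decomposition"
    "Jordan_Normal_Form.DL_Rank"
    "Jordan_Normal_Form.DL_Submatrix"
begin

text \<open>Matrices of a fixed dimension do not form a type, so \<open>sum\<close> does not apply to them;
  the dimension \<open>n\<close> fixes the value of the empty sum.\<close>

definition mat_setsum :: "nat \<Rightarrow> ('i \<Rightarrow> 'a :: comm_monoid_add mat) \<Rightarrow> 'i set \<Rightarrow> 'a mat" where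
  "mat_setsum n F S = mat n n (\<lambda>pq. \<Sum>i\<in>S. F i $$ pq)"


section \<open>Invariant factors and minimal polynomials\<close>

text \<open>The invariant factors of \<open>A\<close> are those of the polynomial matrix \<open>x I - A\<close>, that is, the
  quotients \<open>d\<^sub>r / d\<^sub>r\<^sub>-\<^sub>1\<close> of successive determinantal divisors, \<open>d\<^sub>r\<close> being the monic gcd of all
  minors of order \<open>r\<close> (and \<open>d\<^sub>0 = 1\<close>, the determinant of the empty matrix).\<close>

definition determinantal_divisor :: "complex poly mat \<Rightarrow> nat \<Rightarrow> complex poly" where
  "determinantal_divisor P r =
     Gcd {det (submatrix P I J) | I J. I \<subseteq> {..<dim_row P} \<and> J \<subseteq> {..<dim_col P} \<and>
                                      card I = r \<and> card J = r}"

definition invariant_factor :: "complex mat \<Rightarrow> nat \<Rightarrow> complex poly" where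
  "invariant_factor A r =
     determinantal_divisor (char_poly_matrix A) r div
     determinantal_divisor (char_poly_matrix A) (r - 1)"

definition nontrivial_invariant_factors :: "complex mat \<Rightarrow> complex poly list" where
  "nontrivial_invariant_factors A =
     filter (\<lambda>p. p \<noteq> 1) (map (invariant_factor A) [1..<Suc (dim_row A)])"

definition cyclic_index :: "complex mat \<Rightarrow> nat" where
  "cyclic_index A = length (nontrivial_invariant_factors A)"

definition poly_at_mat :: "complex poly \<Rightarrow> complex mat \<Rightarrow> complex mat" where
  "poly_at_mat p A = mat_setsum (dim_row A) (\<lambda>i. coeff p i \<cdot>\<^sub>m (A ^\<^sub>m i)) {..degree p}"

definition is_minimal_poly :: "complex mat \<Rightarrow> complex poly \<Rightarrow> bool" where
  "is_minimal_poly A p \<longleftrightarrow>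
     lead_coeff p = 1 \<and> poly_at_mat p A = 0\<^sub>m (dim_row A) (dim_row A) \<and>
     (\<forall>q. q \<noteq> 0 \<and> poly_at_mat q A = 0\<^sub>m (dim_row A) (dim_row A) \<longrightarrow> degree p \<le> degree q)"


section \<open>Controllable pairs and cyclic matrices\<close>

text \<open>\<open>[B, A B, \<dots>, A\<^bsup>n-1\<^esup> B]\<close>: column \<open>c\<close> is column \<open>c mod m\<close> of \<open>A\<^bsup>c div m\<^esup> B\<close>.\<close>

definition controllability_mat :: "complex mat \<Rightarrow> complex mat \<Rightarrow> complex mat" where
  "controllability_mat A B =
     mat (dim_row A) (dim_row A * dim_col B)
       (\<lambda>(r, c). (A ^\<^sub>m (c div dim_col B) * B) $$ (r, c mod dim_col B))"

definition controllable :: "complex mat \<Rightarrow> complex mat \<Rightarrow> bool" where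
  "controllable A B \<longleftrightarrow> vec_space.rank (dim_row A) (controllability_mat A B) = dim_row A"

text \<open>Existence of a cyclic vector: \<open>g, A g, A\<^sup>2 g, \<dots>\<close> span the space.\<close>

definition cyclic_mat :: "complex mat \<Rightarrow> bool" where
  "cyclic_mat A \<longleftrightarrow>
     (\<exists>g \<in> carrier_vec (dim_row A). controllable A (mat_of_cols (dim_row A) [g]))"


section \<open>The block form\<close>

text \<open>All indices are zero-based here: \<open>block_col As B i j\<close> is the part of column \<open>j\<close> of \<open>B\<close> in the
  rows of the \<open>i\<close>-th diagonal block, that is, the column vector \<open>b\<close> with index pair
  \<open>(i + 1, j + 1)\<close> as an \<open>n\<^sub>i \<times> 1\<close> matrix.\<close>

definition block_col :: "complex mat list \<Rightarrow> complex mat \<Rightarrow> nat \<Rightarrow> nat \<Rightarrow> complex mat" where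
  "block_col As B i j =
     mat (dim_row (As ! i)) 1 (\<lambda>(r, _). B $$ (sum_list (map dim_row (take i As)) + r, j))"

text \<open>The list \<open>\<alpha>s\<close> is an arbitrary enumeration of the non-trivial invariant factors, with
  multiplicity; both usual orders (each factor dividing the next, or the converse) are covered.
  Columns of \<open>B\<close> with index at least \<open>k\<close> are unconstrained.\<close>

definition cyclic_block_form ::
    "complex mat \<Rightarrow> complex mat \<Rightarrow> complex mat list \<Rightarrow> complex poly list \<Rightarrow> bool" where
  "cyclic_block_form A B As \<alpha>s \<longleftrightarrow>
     (let k = cyclic_index A in
       k \<le> dim_col B \<and> length As = k \<and>
       mset \<alpha>s = mset (nontrivial_invariant_factors A) \<and>
       A = diag_block_mat As \<and>
       (\<forall>i<k. square_mat (As ! i) \<and> cyclic_mat (As ! i) \<and> is_minimal_poly (As ! i) (\<alpha>s ! i)) \<and>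
       (\<forall>i<k. controllable (As ! i) (block_col As B i i)) \<and>
       (\<forall>i<k. \<forall>j<i. block_col As B i j = 0\<^sub>m (dim_row (As ! i)) 1))"


section \<open>Gramians\<close>

definition switched_gramian ::
    "complex mat \<Rightarrow> complex mat \<Rightarrow> (nat \<Rightarrow> complex) \<Rightarrow> nat \<Rightarrow> complex mat" where
  "switched_gramian A C \<sigma> t =
     mat_setsum (dim_row A)
       (\<lambda>i. \<sigma> (t - i) \<cdot>\<^sub>m (A ^\<^sub>m i * C * mat_adjoint C * (mat_adjoint A ^\<^sub>m i))) {0..t}"

text \<open>The matrix whose columns are those columns of \<open>B\<close> with (zero-based) index at least \<open>k\<close>.
  It has no columns, so contributes a zero Gramian, if \<open>B\<close> has exactly \<open>k\<close> columns.\<close>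

definition remaining_cols :: "complex mat \<Rightarrow> nat \<Rightarrow> complex mat" where
  "remaining_cols B k = mat (dim_row B) (dim_col B - k) (\<lambda>(r, c). B $$ (r, k + c))"

text \<open>Here \<open>j\<close> ranges over \<open>1, \<dots>, k + 1\<close> with \<open>k\<close> the cyclic index of \<open>A\<close>.\<close>

definition partial_gramian ::
    "complex mat \<Rightarrow> complex mat \<Rightarrow> (nat \<Rightarrow> complex) \<Rightarrow> nat \<Rightarrow> nat \<Rightarrow> complex mat" where
  "partial_gramian A B \<sigma> t j =
     switched_gramian A
       (if j \<le> cyclic_index A then mat_of_cols (dim_row B) [col B (j - 1)]
        else remaining_cols B (cyclic_index A)) \<sigma> t"

text \<open>Since \<open>w \<bullet>c v = \<Sum>i. w\<^sub>i * cnj v\<^sub>i\<close>, the form below is \<open>v\<^sup>* W v\<close>; in the order on the complex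
  numbers, \<open>0 < z\<close> means that \<open>z\<close> is real and positive.\<close>

definition positive_definite_mat :: "complex mat \<Rightarrow> bool" where
  "positive_definite_mat W \<longleftrightarrow>
     square_mat W \<and> mat_adjoint W = W \<and>
     (\<forall>v \<in> carrier_vec (dim_row W). v \<noteq> 0\<^sub>v (dim_row W) \<longrightarrow> 0 < (W *\<^sub>v v) \<bullet>c v)"

end

theory Submission
  imports Defs
begin

text \<open>With \<open>P\<^sub>i = A\<^sup>i C\<close>, the Gramian of a pair \<open>(A, C)\<close> is the sum of the matrices
  \<open>\<sigma>(t - i) P\<^sub>i P\<^sub>i\<^sup>*\<close>, a nonnegative combination of positive semidefinite matrices, and its
  quadratic form is \<open>\<Sum>i. \<sigma>(t - i) |P\<^sub>i\<^sup>* v|\<^sup>2\<close> (\<open>quadratic_form_weighted_sum\<close>). Hence it is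
  positive definite iff its kernel is zero (\<open>positive_definite_switched_gramian_iff\<close>), and \<open>v\<close>
  lies in the kernel iff \<open>v\<close> is orthogonal to \<open>A\<^sup>i c\<close> for every column \<open>c\<close> of \<open>C\<close> and every \<open>i\<close>
  with \<open>\<sigma>(t - i) = 1\<close> (\<open>mat_kernel_switched_gramian\<close>).

  The latter condition is imposed on each column separately. So whenever the columns of \<open>B\<close> are
  distributed over several matrices, the kernel of the Gramian of \<open>(A, B)\<close> is the intersection of
  the kernels of the Gramians of these matrices. The block form enters through the bound \<open>k \<le> m\<close>,
  which makes the first \<open>k\<close> columns and the remaining ones such a distribution.\<close>


section \<open>The adjoint of a matrix\<close>

lemma dim_mat_adjoint [simp]:
  "dim_row (mat_adjoint A) = dim_col A" "dim_col (mat_adjoint A) = dim_row A"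
  unfolding mat_adjoint_def by auto

lemma mat_adjoint_carrier:
  "A \<in> carrier_mat n m \<Longrightarrow> mat_adjoint A \<in> carrier_mat m n"
  by (intro carrier_matI) auto

lemma mat_adjoint_index [simp]:
  "i < dim_col A \<Longrightarrow> j < dim_row A \<Longrightarrow> mat_adjoint A $$ (i, j) = conjugate (A $$ (j, i))"
  unfolding mat_adjoint_def by (simp add: mat_of_rows_index)

lemma mat_adjoint_mult:
  assumes A: "A \<in> carrier_mat n m" and B: "B \<in> carrier_mat m p"
  shows "mat_adjoint (A * B) = mat_adjoint B * mat_adjoint A"
  by (rule eq_matI) (use A B in \<open>auto simp: scalar_prod_def sum_conjugate conjugate_dist_mul
      mult.commute intro!: sum.cong\<close>)

lemma mat_adjoint_adjoint [simp]: "mat_adjoint (mat_adjoint A) = A"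
  by (rule eq_matI) auto

lemma mat_adjoint_one: "mat_adjoint (1\<^sub>m n :: complex mat) = 1\<^sub>m n"
  by (rule eq_matI) auto

lemma pow_mat_commute:
  assumes A: "A \<in> carrier_mat n n"
  shows "A * A ^\<^sub>m i = A ^\<^sub>m i * A"
proof (induction i)
  case (Suc i)
  then show ?case
    using assoc_mult_mat[OF A pow_carrier_mat[OF A] A, of i] by simp
qed (use A in auto)

lemma mat_adjoint_pow:
  fixes A :: "complex mat"
  assumes A: "A \<in> carrier_mat n n"
  shows "mat_adjoint (A ^\<^sub>m i) = mat_adjoint A ^\<^sub>m i"
proof (induction i)
  case 0
  then show ?case using A by (simp add: mat_adjoint_one)
next
  case (Suc i)
  have "mat_adjoint (A ^\<^sub>m Suc i) = mat_adjoint A * mat_adjoint A ^\<^sub>m i"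
    using mat_adjoint_mult[OF pow_carrier_mat[OF A] A, of i] Suc by simp
  then show ?case
    using pow_mat_commute[OF mat_adjoint_carrier[OF A], of i] by simp
qed

lemma mat_adjoint_mult_vec_index:
  fixes P :: "complex mat"
  assumes P: "P \<in> carrier_mat n p" and v: "v \<in> carrier_vec n" and c: "c < p"
  shows "(mat_adjoint P *\<^sub>v v) $ c = v \<bullet>c col P c"
  using P v c by (auto simp: scalar_prod_def mult.commute intro!: sum.cong)

lemma adjoint_cscalar_prod:
  fixes P :: "complex mat"
  assumes P: "P \<in> carrier_mat n p" and u: "u \<in> carrier_vec p" and v: "v \<in> carrier_vec n"
  shows "(P *\<^sub>v u) \<bullet>c v = u \<bullet>c (mat_adjoint P *\<^sub>v v)"
proof -
  have "(P *\<^sub>v u) \<bullet>c v = (\<Sum>i<n. \<Sum>j<p. P $$ (i, j) * u $ j * conjugate (v $ i))"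
    using P u v by (auto simp: scalar_prod_def sum_distrib_right lessThan_atLeast0)
  also have "\<dots> = (\<Sum>j<p. \<Sum>i<n. P $$ (i, j) * u $ j * conjugate (v $ i))"
    by (rule sum.swap)
  also have "\<dots> = u \<bullet>c (mat_adjoint P *\<^sub>v v)"
    using P u v
    by (auto simp: scalar_prod_def sum_distrib_left sum_conjugate conjugate_dist_mul
        lessThan_atLeast0 mult.commute mult.left_commute
        intro!: sum.cong)
  finally show ?thesis .
qed

lemma smult_mult_mat_adjoint_vec:
  fixes P :: "complex mat"
  assumes P: "P \<in> carrier_mat n p" and v: "v \<in> carrier_vec n"
  shows "a \<cdot>\<^sub>m (P * mat_adjoint P) *\<^sub>v v = a \<cdot>\<^sub>v (P *\<^sub>v (mat_adjoint P *\<^sub>v v))"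
proof -
  have "a \<cdot>\<^sub>m (P * mat_adjoint P) *\<^sub>v v = a \<cdot>\<^sub>v (P * mat_adjoint P *\<^sub>v v)"
    using P v by (intro eq_vecI) auto
  then show ?thesis
    using assoc_mult_mat_vec[OF P mat_adjoint_carrier[OF P] v] by simp
qed


section \<open>Weighted sums of matrices of the form P P*\<close>

lemma mat_setsum_mult_vec_index:
  fixes F :: "'i \<Rightarrow> 'a :: comm_semiring_0 mat"
  assumes F: "\<And>i. i \<in> S \<Longrightarrow> F i \<in> carrier_mat n n" and v: "v \<in> carrier_vec n" and r: "r < n"
  shows "(mat_setsum n F S *\<^sub>v v) $ r = (\<Sum>i\<in>S. (F i *\<^sub>v v) $ r)"
proof -
  have "(mat_setsum n F S *\<^sub>v v) $ r = (\<Sum>q<n. \<Sum>i\<in>S. F i $$ (r, q) * v $ q)"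
    using v r by (auto simp: mat_setsum_def scalar_prod_def sum_distrib_right lessThan_atLeast0)
  also have "\<dots> = (\<Sum>i\<in>S. \<Sum>q<n. F i $$ (r, q) * v $ q)"
    by (rule sum.swap)
  also have "\<dots> = (\<Sum>i\<in>S. (F i *\<^sub>v v) $ r)"
  proof (rule sum.cong)
    fix i assume "i \<in> S"
    from F[OF this] show "(\<Sum>q<n. F i $$ (r, q) * v $ q) = (F i *\<^sub>v v) $ r"
      using v r by (auto simp: scalar_prod_def lessThan_atLeast0)
  qed simp
  finally show ?thesis .
qed

lemma quadratic_form_mat_setsum:
  fixes F :: "'i \<Rightarrow> complex mat"
  assumes F: "\<And>i. i \<in> S \<Longrightarrow> F i \<in> carrier_mat n n" and v: "v \<in> carrier_vec n"
  shows "(mat_setsum n F S *\<^sub>v v) \<bullet>c v = (\<Sum>i\<in>S. (F i *\<^sub>v v) \<bullet>c v)"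
proof -
  have "(mat_setsum n F S *\<^sub>v v) \<bullet>c v
      = (\<Sum>r<n. (mat_setsum n F S *\<^sub>v v) $ r * conjugate (v $ r))"
    using v by (auto simp: scalar_prod_def lessThan_atLeast0)
  also have "\<dots> = (\<Sum>r<n. \<Sum>i\<in>S. (F i *\<^sub>v v) $ r * conjugate (v $ r))"
    by (intro sum.cong refl) (simp add: mat_setsum_mult_vec_index[OF F v] sum_distrib_right)
  also have "\<dots> = (\<Sum>i\<in>S. \<Sum>r<n. (F i *\<^sub>v v) $ r * conjugate (v $ r))"
    by (rule sum.swap)
  also have "\<dots> = (\<Sum>i\<in>S. (F i *\<^sub>v v) \<bullet>c v)"
    using v by (auto simp: scalar_prod_def lessThan_atLeast0)
  finally show ?thesis .
qed

text \<open>Each summand \<open>P P\<^sup>*\<close> contributes the nonnegative number \<open>|P\<^sup>* v|\<^sup>2\<close> to the quadratic form.\<close>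

lemma quadratic_form_weighted_sum:
  fixes P :: "'i \<Rightarrow> complex mat"
  assumes P: "\<And>i. i \<in> S \<Longrightarrow> P i \<in> carrier_mat n p" and v: "v \<in> carrier_vec n"
  shows "(mat_setsum n (\<lambda>i. w i \<cdot>\<^sub>m (P i * mat_adjoint (P i))) S *\<^sub>v v) \<bullet>c v
    = (\<Sum>i\<in>S. w i * ((mat_adjoint (P i) *\<^sub>v v) \<bullet>c (mat_adjoint (P i) *\<^sub>v v)))"
proof -
  have "(w i \<cdot>\<^sub>m (P i * mat_adjoint (P i)) *\<^sub>v v) \<bullet>c v
      = w i * ((mat_adjoint (P i) *\<^sub>v v) \<bullet>c (mat_adjoint (P i) *\<^sub>v v))" if "i \<in> S" for i
  proof -
    note Pi = P[OF that]
    note Qi = mat_adjoint_carrier[OF Pi]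
    have Qv: "mat_adjoint (P i) *\<^sub>v v \<in> carrier_vec p"
      using mult_mat_vec_carrier[OF Qi v] .
    have "w i \<cdot>\<^sub>m (P i * mat_adjoint (P i)) *\<^sub>v v
        = w i \<cdot>\<^sub>v (P i *\<^sub>v (mat_adjoint (P i) *\<^sub>v v))"
      by (rule smult_mult_mat_adjoint_vec[OF Pi v])
    then show ?thesis
      using adjoint_cscalar_prod[OF Pi Qv v] Pi v Qv by simp
  qed
  then show ?thesis
    using P v by (subst quadratic_form_mat_setsum) (auto intro!: smult_carrier_mat mult_carrier_mat mat_adjoint_carrier)
qed

lemma mat_adjoint_weighted_sum:
  fixes P :: "'i \<Rightarrow> complex mat"
  assumes P: "\<And>i. i \<in> S \<Longrightarrow> P i \<in> carrier_mat n p" and w: "\<And>i. i \<in> S \<Longrightarrow> 0 \<le> w i"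
  shows "mat_adjoint (mat_setsum n (\<lambda>i. w i \<cdot>\<^sub>m (P i * mat_adjoint (P i))) S)
    = mat_setsum n (\<lambda>i. w i \<cdot>\<^sub>m (P i * mat_adjoint (P i))) S" (is "mat_adjoint ?W = ?W")
proof (rule eq_matI)
  have W: "?W \<in> carrier_mat n n" by (simp add: mat_setsum_def)
  fix r q assume "r < dim_row ?W" "q < dim_col ?W"
  then have rq: "r < n" "q < n" using W by auto
  have "conjugate ((w i \<cdot>\<^sub>m (P i * mat_adjoint (P i))) $$ (q, r))
      = (w i \<cdot>\<^sub>m (P i * mat_adjoint (P i))) $$ (r, q)" if i: "i \<in> S" for i
  proof -
    note Pi = P[OF i]
    have "mat_adjoint (P i * mat_adjoint (P i)) = P i * mat_adjoint (P i)"
      using mat_adjoint_mult[OF Pi mat_adjoint_carrier[OF Pi]] by simp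
    then have "conjugate ((P i * mat_adjoint (P i)) $$ (q, r)) = (P i * mat_adjoint (P i)) $$ (r, q)"
      using mat_adjoint_index[of r "P i * mat_adjoint (P i)" q] rq Pi by simp
    moreover have "conjugate (w i) = w i"
      using w[OF i] by (simp add: complex_eq_iff less_eq_complex_def)
    ultimately show ?thesis
      using rq Pi mat_adjoint_carrier[OF Pi] by (simp add: conjugate_dist_mul)
  qed
  then show "mat_adjoint ?W $$ (r, q) = ?W $$ (r, q)"
    using rq mat_adjoint_index[of r ?W q] W
    by (cases "finite S")
      (simp_all add: mat_setsum_def sum_conjugate del: index_mult_mat index_smult_mat conjugate_complex_def)
qed (auto simp: mat_setsum_def)

text \<open>A sum of nonnegative numbers vanishes only if every term does, so a vector on which the
  quadratic form vanishes is killed by each \<open>P\<^sup>*\<close> of nonzero weight, and then by the whole sum.\<close>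

lemma weighted_sum_semidefinite:
  fixes P :: "'i \<Rightarrow> complex mat"
  assumes fin: "finite S" and P: "\<And>i. i \<in> S \<Longrightarrow> P i \<in> carrier_mat n p"
    and w: "\<And>i. i \<in> S \<Longrightarrow> 0 \<le> w i" and v: "v \<in> carrier_vec n"
  defines "W \<equiv> mat_setsum n (\<lambda>i. w i \<cdot>\<^sub>m (P i * mat_adjoint (P i))) S"
  shows "0 \<le> (W *\<^sub>v v) \<bullet>c v"
    and "(W *\<^sub>v v) \<bullet>c v = 0 \<longleftrightarrow> W *\<^sub>v v = 0\<^sub>v n"
    and "W *\<^sub>v v = 0\<^sub>v n \<longleftrightarrow> (\<forall>i\<in>S. w i \<noteq> 0 \<longrightarrow> mat_adjoint (P i) *\<^sub>v v = 0\<^sub>v p)"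
proof -
  let ?y = "\<lambda>i. mat_adjoint (P i) *\<^sub>v v"
  have y: "?y i \<in> carrier_vec p" if "i \<in> S" for i
    using mult_mat_vec_carrier[OF mat_adjoint_carrier[OF P[OF that]] v] .
  have form: "(W *\<^sub>v v) \<bullet>c v = (\<Sum>i\<in>S. w i * (?y i \<bullet>c ?y i))"
    unfolding W_def by (rule quadratic_form_weighted_sum[OF P v])
  have nonneg: "0 \<le> w i * (?y i \<bullet>c ?y i)" if "i \<in> S" for i
    by (intro mult_nonneg_nonneg w[OF that] conjugate_square_ge_0_vec)
  show "0 \<le> (W *\<^sub>v v) \<bullet>c v" unfolding form by (rule sum_nonneg[OF nonneg])
  have killed: "(\<forall>i\<in>S. w i \<noteq> 0 \<longrightarrow> ?y i = 0\<^sub>v p) \<longleftrightarrow> (W *\<^sub>v v) \<bullet>c v = 0"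
  proof -
    have "(W *\<^sub>v v) \<bullet>c v = 0 \<longleftrightarrow> (\<forall>i\<in>S. w i * (?y i \<bullet>c ?y i) = 0)"
      unfolding form by (rule sum_nonneg_eq_0_iff[OF fin nonneg])
    then show ?thesis
      using conjugate_square_eq_0_vec[OF y] by auto
  qed
  have zero: "W *\<^sub>v v = 0\<^sub>v n" if *: "\<forall>i\<in>S. w i \<noteq> 0 \<longrightarrow> ?y i = 0\<^sub>v p"
  proof -
    let ?F = "\<lambda>i. w i \<cdot>\<^sub>m (P i * mat_adjoint (P i))"
    have F0: "?F i *\<^sub>v v = 0\<^sub>v n" if i: "i \<in> S" for i
    proof -
      note Pi = P[OF i]
      have "?F i *\<^sub>v v = w i \<cdot>\<^sub>v (P i *\<^sub>v ?y i)"
        by (rule smult_mult_mat_adjoint_vec[OF Pi v])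
      then show ?thesis using * i Pi by (cases "w i = 0") (auto intro!: eq_vecI)
    qed
    have F: "?F i \<in> carrier_mat n n" if "i \<in> S" for i
      using P[OF that] by (auto intro!: smult_carrier_mat mult_carrier_mat)
    show ?thesis
    proof (rule eq_vecI)
      fix r assume "r < dim_vec (0\<^sub>v n :: complex vec)"
      then have r: "r < n" by simp
      have "(W *\<^sub>v v) $ r = (\<Sum>i\<in>S. (?F i *\<^sub>v v) $ r)"
        unfolding W_def by (rule mat_setsum_mult_vec_index[OF F v r])
      also have "\<dots> = 0"
        by (rule sum.neutral) (use F0 r in \<open>metis index_zero_vec(1)\<close>)
      finally show "(W *\<^sub>v v) $ r = 0\<^sub>v n $ r" using r by simp
    qed (simp add: W_def mat_setsum_def)
  qed
  have "(W *\<^sub>v v) \<bullet>c v = 0" if "W *\<^sub>v v = 0\<^sub>v n" using that v by simp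
  with zero killed
  show "(W *\<^sub>v v) \<bullet>c v = 0 \<longleftrightarrow> W *\<^sub>v v = 0\<^sub>v n"
    and "W *\<^sub>v v = 0\<^sub>v n \<longleftrightarrow> (\<forall>i\<in>S. w i \<noteq> 0 \<longrightarrow> ?y i = 0\<^sub>v p)"
    by blast+
qed


section \<open>The kernel of a switched Gramian\<close>

lemma switched_gramian_factored:
  assumes A: "A \<in> carrier_mat n n" and C: "C \<in> carrier_mat n p"
  shows "switched_gramian A C \<sigma> t =
    mat_setsum n (\<lambda>i. \<sigma> (t - i) \<cdot>\<^sub>m (A ^\<^sub>m i * C * mat_adjoint (A ^\<^sub>m i * C))) {0..t}"
proof -
  have "A ^\<^sub>m i * C * mat_adjoint C * mat_adjoint A ^\<^sub>m i
      = A ^\<^sub>m i * C * mat_adjoint (A ^\<^sub>m i * C)" for i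
    using mat_adjoint_mult[OF pow_carrier_mat[OF A] C, of i] mat_adjoint_pow[OF A, of i]
      assoc_mult_mat[OF mult_carrier_mat[OF pow_carrier_mat[OF A] C] mat_adjoint_carrier[OF C]
        pow_carrier_mat[OF mat_adjoint_carrier[OF A]], of i i]
    by simp
  then show ?thesis using A by (simp add: switched_gramian_def)
qed

lemma switched_gramian_carrier:
  "A \<in> carrier_mat n n \<Longrightarrow> switched_gramian A C \<sigma> t \<in> carrier_mat n n"
  by (simp add: switched_gramian_def mat_setsum_def)

lemma mat_adjoint_mult_vec_eq_0_iff:
  fixes A C :: "complex mat"
  assumes A: "A \<in> carrier_mat n n" and C: "C \<in> carrier_mat n p" and v: "v \<in> carrier_vec n"
  shows "mat_adjoint (A * C) *\<^sub>v v = 0\<^sub>v p \<longleftrightarrow> (\<forall>c\<in>set (cols C). v \<bullet>c (A *\<^sub>v c) = 0)"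
proof -
  note AC = mult_carrier_mat[OF A C]
  have "mat_adjoint (A * C) *\<^sub>v v = 0\<^sub>v p
      \<longleftrightarrow> (\<forall>j<p. (mat_adjoint (A * C) *\<^sub>v v) $ j = 0)"
    using mat_adjoint_carrier[OF AC] by (auto simp: vec_eq_iff)
  also have "\<dots> \<longleftrightarrow> (\<forall>j<p. v \<bullet>c (A *\<^sub>v col C j) = 0)"
    using mat_adjoint_mult_vec_index[OF AC v] col_mult2[OF A C] by simp
  also have "\<dots> \<longleftrightarrow> (\<forall>c\<in>set (cols C). v \<bullet>c (A *\<^sub>v c) = 0)"
    using C by (auto simp: cols_def)
  finally show ?thesis .
qed

text \<open>The kernel depends on \<open>C\<close> only through its set of columns, one condition per column; this
  is what makes it split as an intersection.\<close>

lemma mat_kernel_switched_gramian: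
  assumes A: "A \<in> carrier_mat n n" and C: "C \<in> carrier_mat n p" and \<sigma>: "\<forall>s. \<sigma> s \<in> {0, 1}"
  shows "mat_kernel (switched_gramian A C \<sigma> t) =
    {v \<in> carrier_vec n. \<forall>c\<in>set (cols C). \<forall>i\<le>t. \<sigma> (t - i) = 1 \<longrightarrow> v \<bullet>c (A ^\<^sub>m i *\<^sub>v c) = 0}"
proof -
  have P: "A ^\<^sub>m i * C \<in> carrier_mat n p" for i
    by (rule mult_carrier_mat[OF pow_carrier_mat[OF A] C])
  have w: "0 \<le> \<sigma> (t - i)" for i using \<sigma>[rule_format, of "t - i"] by (auto simp: less_eq_complex_def)
  have one: "\<sigma> s \<noteq> 0 \<longleftrightarrow> \<sigma> s = 1" for s using \<sigma>[rule_format, of s] by auto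
  have "switched_gramian A C \<sigma> t *\<^sub>v v = 0\<^sub>v n
      \<longleftrightarrow> (\<forall>c\<in>set (cols C). \<forall>i\<le>t. \<sigma> (t - i) = 1 \<longrightarrow> v \<bullet>c (A ^\<^sub>m i *\<^sub>v c) = 0)"
    if v: "v \<in> carrier_vec n" for v
    unfolding switched_gramian_factored[OF A C]
      weighted_sum_semidefinite(3)[OF finite_atLeastAtMost P w v] one
      mat_adjoint_mult_vec_eq_0_iff[OF pow_carrier_mat[OF A] C v]
    by auto
  then show ?thesis
    using switched_gramian_carrier[OF A, of C \<sigma> t] by (auto simp: mat_kernel_def)
qed

lemma positive_definite_switched_gramian_iff:
  assumes A: "A \<in> carrier_mat n n" and C: "C \<in> carrier_mat n p" and \<sigma>: "\<forall>s. \<sigma> s \<in> {0, 1}"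
  shows "positive_definite_mat (switched_gramian A C \<sigma> t)
    \<longleftrightarrow> mat_kernel (switched_gramian A C \<sigma> t) = {0\<^sub>v n}"
proof -
  let ?W = "switched_gramian A C \<sigma> t"
  have P: "A ^\<^sub>m i * C \<in> carrier_mat n p" for i
    by (rule mult_carrier_mat[OF pow_carrier_mat[OF A] C])
  have w: "0 \<le> \<sigma> (t - i)" for i using \<sigma>[rule_format, of "t - i"] by (auto simp: less_eq_complex_def)
  have W: "?W \<in> carrier_mat n n" using switched_gramian_carrier[OF A] .
  have herm: "mat_adjoint ?W = ?W"
    unfolding switched_gramian_factored[OF A C] by (rule mat_adjoint_weighted_sum[OF P w])
  have pos: "0 < (?W *\<^sub>v v) \<bullet>c v \<longleftrightarrow> ?W *\<^sub>v v \<noteq> 0\<^sub>v n" if v: "v \<in> carrier_vec n" for v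
  proof -
    have "0 \<le> (?W *\<^sub>v v) \<bullet>c v"
      unfolding switched_gramian_factored[OF A C]
      by (rule weighted_sum_semidefinite(1)[OF finite_atLeastAtMost P w v])
    moreover have "(?W *\<^sub>v v) \<bullet>c v = 0 \<longleftrightarrow> ?W *\<^sub>v v = 0\<^sub>v n"
      unfolding switched_gramian_factored[OF A C]
      by (rule weighted_sum_semidefinite(2)[OF finite_atLeastAtMost P w v])
    ultimately show ?thesis by (auto simp: order_less_le)
  qed
  have "?W *\<^sub>v 0\<^sub>v n = 0\<^sub>v n" using W by auto
  then show ?thesis
    using W herm pos by (auto simp: positive_definite_mat_def mat_kernel_def)
qed


section \<open>Distributing the columns of B\<close>

lemma set_cols_remaining_cols:
  "set (cols (remaining_cols B k)) = col B ` {k..<dim_col B}"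
proof -
  have "col (remaining_cols B k) c = col B (k + c)" if "c < dim_col B - k" for c
    using that by (intro eq_vecI) (auto simp: remaining_cols_def)
  then have "set (cols (remaining_cols B k)) = (\<lambda>c. col B (k + c)) ` {0..<dim_col B - k}"
    unfolding cols_def by (auto simp: remaining_cols_def)
  also have "\<dots> = col B ` {k..<dim_col B}"
  proof
    show "col B ` {k..<dim_col B} \<subseteq> (\<lambda>c. col B (k + c)) ` {0..<dim_col B - k}"
      by (rule image_subsetI, rule_tac x = "x - k" in rev_image_eqI) auto
  qed auto
  finally show ?thesis .
qed

theorem corollary3p1:
  fixes A B :: "complex mat" and As :: "complex mat list" and \<alpha>s :: "complex poly list"
    and \<sigma> :: "nat \<Rightarrow> complex" and n m t :: nat
  assumes "A \<in> carrier_mat n n" and "B \<in> carrier_mat n m"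
    and "controllable A B"
    and "cyclic_block_form A B As \<alpha>s"
    and "\<forall>s. \<sigma> s \<in> {0, 1}"
  shows "positive_definite_mat (switched_gramian A B \<sigma> t) \<longleftrightarrow>
         (\<Inter>i\<in>{1..cyclic_index A + 1}. mat_kernel (partial_gramian A B \<sigma> t i)) = {0\<^sub>v n}"
proof -
  note A = assms(1) and B = assms(2) and \<sigma> = assms(5)
  define k where "k = cyclic_index A"
  have km: "k \<le> m"
    using assms(4) B unfolding cyclic_block_form_def k_def Let_def by auto
  define C where "C j = (if j \<le> k then mat_of_cols n [col B (j - 1)] else remaining_cols B k)" for j
  define unseen where
    "unseen v c \<longleftrightarrow> (\<forall>i\<le>t. \<sigma> (t - i) = 1 \<longrightarrow> v \<bullet>c (A ^\<^sub>m i *\<^sub>v c) = 0)" for v c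
  have kernel: "mat_kernel (switched_gramian A D \<sigma> t)
      = {v \<in> carrier_vec n. \<forall>c\<in>set (cols D). unseen v c}" if "dim_row D = n" for D
    unfolding unseen_def
    by (rule mat_kernel_switched_gramian[OF A _ \<sigma>, of D "dim_col D"]) (use that in auto)
  have dimC: "dim_row (C j) = n" for j
    using B by (simp add: C_def remaining_cols_def)
  have colsC: "set (cols (C j)) = (if j \<le> k then {col B (j - 1)} else col B ` {k..<m})" for j
    using B by (auto simp: C_def set_cols_remaining_cols)
  have "(\<Union>j\<in>{1..k + 1}. set (cols (C j))) = set (cols B)"
  proof -
    have "{1..k + 1} = insert (k + 1) (Suc ` {0..<k})"
      by (auto simp: image_Suc_atLeastLessThan)
    then have "(\<Union>j\<in>{1..k + 1}. set (cols (C j)))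
        = set (cols (C (k + 1))) \<union> (\<Union>j\<in>{0..<k}. set (cols (C (Suc j))))"
      by (simp only: UN_insert UN_simps(10))
    also have "\<dots> = col B ` {k..<m} \<union> col B ` {0..<k}"
      by (auto simp: colsC)
    also have "\<dots> = col B ` ({0..<k} \<union> {k..<m})" by auto
    also have "\<dots> = set (cols B)"
      using B km by (simp add: ivl_disj_un_two(3) cols_def)
    finally show ?thesis .
  qed
  moreover have "partial_gramian A B \<sigma> t j = switched_gramian A (C j) \<sigma> t" for j
    using B by (simp add: partial_gramian_def C_def k_def)
  ultimately have "(\<Inter>j\<in>{1..k + 1}. mat_kernel (partial_gramian A B \<sigma> t j))
      = mat_kernel (switched_gramian A B \<sigma> t)"
    using B by (auto simp: kernel dimC)
  then show ?thesis
    using positive_definite_switched_gramian_iff[OF A B \<sigma>] by (simp add: k_def)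
qed

end
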